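(* Let $t>1$ be an integer and let $n\ge 0$ be an integer. Then $E_n(1,x)$ is a permutation polynomial over $\mathbb{Z}_{2^t}$ if and only if $n\equiv 2\pmod 6$.
   Context: The $n$th reversed Dickson polynomial of the second kind (with parameter $1$) is the integer-coefficient polynomial $E_n(1,x)=\sum_{i=0}^{\lfloor n/2\rfloor}\binom{n-i}{i}(-x)^i$; equivalently $E_0(1,x)=1$, $E_1(1,x)=1$, $E_n(1,x)=E_{n-1}(1,x)-x\,E_{n-2}(1,x)$ for $n\ge 2$. $\mathbb{Z}_m$ is the ring of integers modulo $m$; an integer polynomial is a permutation polynomial over $\mathbb{Z}_m$ if the map it induces $\mathbb{Z}_m\to\mathbb{Z}_m$ is a bijection. *)

theory Defs
  imports "HOL-Computational_Algebra.Polynomial" "HOL-Number_Theory.Residues"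
begin

definition rev_dickson2 :: "nat \<Rightarrow> int poly" where
  "rev_dickson2 n = (\<Sum>i = 0..n div 2. of_nat ((n - i) choose i) * (- [:0, 1:]) ^ i)"

text \<open>The ring of integers modulo \<open>m\<close> is the library's \<open>residue_ring m\<close>, whose elements are the
  representatives \<open>0, \<dots>, m - 1\<close>; the map induced by an integer polynomial is therefore evaluation
  followed by reduction modulo \<open>m\<close>.\<close>

definition permutation_poly_mod :: "int \<Rightarrow> int poly \<Rightarrow> bool" where
  "permutation_poly_mod m p \<longleftrightarrow>
     bij_betw (\<lambda>a. poly p a mod m) (carrier (residue_ring m)) (carrier (residue_ring m))"

end

theory Submission
  imports Defs
begin

text \<open>
  Write \<open>E n\<close> for the polynomial \<^term>\<open>rev_dickson2 n\<close>.  Everything follows from its recurrence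
  \<open>E (n + 2) = E (n + 1) - x E n\<close>, read modulo 2 and modulo 4.

  Necessity.  A polynomial that permutes the residues modulo \<open>2 ^ t\<close> with \<open>t > 1\<close> also permutes
  them modulo 2 and modulo 4, because surjectivity passes to divisors of the modulus.  Always
  \<open>E n 0 = 1\<close>.  Modulo 2 the values \<open>E n 1\<close> repeat \<open>1, 1, 0\<close>, so separating 0 from 1 forces
  \<open>n mod 3 = 2\<close>.  Modulo 4 one has \<open>E n 2 = 1\<close> for odd \<open>n\<close>, so separating 0 from 2 forces \<open>n\<close> to
  be even.

  Sufficiency.  Factor \<open>E n a - E n b = (a - b) D\<close> with an integer \<open>D\<close>, the divided difference.
  If \<open>2 ^ t\<close> divides the left side and \<open>n mod 6 = 2\<close>, then \<open>a\<close> and \<open>b\<close> have the same parity, since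
  \<open>E n\<close> separates the parities.  When \<open>a\<close> and \<open>b\<close> have the same parity, \<open>D\<close> is odd; this plays the
  role of the classical condition that the derivative vanishes nowhere modulo 2.  Hence \<open>2 ^ t\<close>
  divides \<open>a - b\<close>, so \<open>E n\<close> is injective modulo \<open>2 ^ t\<close>, and therefore a permutation.  The parity
  of \<open>D\<close> is found by running the recurrence that \<open>D\<close> inherits from \<open>E\<close>.
\<close>

section \<open>Permutation polynomials modulo an integer\<close>

lemma permutation_poly_mod_altdef:
  assumes "m > 0"
  shows "permutation_poly_mod m p \<longleftrightarrow> bij_betw (\<lambda>a. poly p a mod m) {0..<m} {0..<m}"
proof -
  have "{0..m - 1} = {0..<m}" by auto
  then show ?thesis
    by (simp add: permutation_poly_mod_def residue_ring_def)
qed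

lemma cong_poly: "[a = b] (mod m) \<Longrightarrow> [poly p a = poly p b] (mod m)" for m :: int
  by (induction p) (auto intro!: cong_add cong_mult)

lemma permutation_poly_mod_iff_inj:
  assumes "m > 0"
  shows "permutation_poly_mod m p \<longleftrightarrow>
    (\<forall>a b. [poly p a = poly p b] (mod m) \<longrightarrow> [a = b] (mod m))"
proof -
  let ?f = "\<lambda>a. poly p a mod m"
  have "?f ` {0..<m} \<subseteq> {0..<m}" using assms by auto
  then have "permutation_poly_mod m p \<longleftrightarrow> inj_on ?f {0..<m}"
    unfolding permutation_poly_mod_altdef[OF assms] bij_betw_def
    using endo_inj_surj[of "{0..<m}" ?f] by auto
  also have "\<dots> \<longleftrightarrow> (\<forall>a b. [poly p a = poly p b] (mod m) \<longrightarrow> [a = b] (mod m))"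
  proof (intro iffI allI impI)
    fix a b assume inj: "inj_on ?f {0..<m}" and ab: "[poly p a = poly p b] (mod m)"
    have "[poly p (a mod m) = poly p a] (mod m)" "[poly p (b mod m) = poly p b] (mod m)"
      by (intro cong_poly; simp)+
    with ab have "?f (a mod m) = ?f (b mod m)" by (simp add: cong_def)
    then have "a mod m = b mod m"
      using inj_onD[OF inj, of "a mod m" "b mod m"] assms by simp
    then show "[a = b] (mod m)" by (simp add: cong_def)
  next
    assume inj: "\<forall>a b. [poly p a = poly p b] (mod m) \<longrightarrow> [a = b] (mod m)"
    show "inj_on ?f {0..<m}"
    proof (rule inj_onI)
      fix a b assume "a \<in> {0..<m}" "b \<in> {0..<m}" "?f a = ?f b"
      moreover from this have "[a = b] (mod m)"
        using inj unfolding cong_def by blast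
      ultimately show "a = b" by (simp add: cong_def)
    qed
  qed
  finally show ?thesis .
qed

lemma permutation_poly_mod_iff_surj:
  assumes "m > 0"
  shows "permutation_poly_mod m p \<longleftrightarrow> (\<forall>c. \<exists>a. [poly p a = c] (mod m))"
proof -
  let ?f = "\<lambda>a. poly p a mod m"
  have im: "?f ` {0..<m} \<subseteq> {0..<m}" using assms by auto
  then have "permutation_poly_mod m p \<longleftrightarrow> {0..<m} \<subseteq> ?f ` {0..<m}"
    unfolding permutation_poly_mod_altdef[OF assms] bij_betw_def
    using finite_surj_inj[of "{0..<m}" ?f] by auto
  also have "\<dots> \<longleftrightarrow> (\<forall>c. \<exists>a. [poly p a = c] (mod m))"
  proof (intro iffI allI subsetI)
    fix c assume "{0..<m} \<subseteq> ?f ` {0..<m}"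
    moreover have "c mod m \<in> {0..<m}" using assms by simp
    ultimately have "c mod m \<in> ?f ` {0..<m}" by blast
    then show "\<exists>a. [poly p a = c] (mod m)" by (auto simp: cong_def)
  next
    fix c assume surj: "\<forall>c. \<exists>a. [poly p a = c] (mod m)" and c: "c \<in> {0..<m}"
    from surj obtain a where "[poly p a = c] (mod m)" by blast
    moreover have "[poly p (a mod m) = poly p a] (mod m)" by (intro cong_poly) simp
    ultimately have "c = ?f (a mod m)" using c by (simp add: cong_def)
    then show "c \<in> ?f ` {0..<m}" using assms by (intro image_eqI[of _ _ "a mod m"]) auto
  qed
  finally show ?thesis .
qed

text \<open>Surjectivity, unlike injectivity, is visibly inherited by every divisor of the modulus.\<close>

lemma permutation_poly_mod_dvd:
  assumes "permutation_poly_mod m p" "d dvd m" "m > 0" "d > 0"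
  shows "permutation_poly_mod d p"
  using assms by (meson permutation_poly_mod_iff_surj cong_dvd_modulus)

section \<open>The recurrence and the divided difference\<close>

text \<open>Since \<open>(n - i) choose i = 0\<close> for \<open>n div 2 < i \<le> n\<close>, the summation range can be made to end at
  \<open>n\<close>; with bounds free of division the recurrence is Pascal's rule.\<close>

lemma rev_dickson2_altdef:
  "rev_dickson2 n = (\<Sum>i\<le>n. of_nat ((n - i) choose i) * (- [:0, 1:]) ^ i)"
  unfolding rev_dickson2_def
  by (rule sum.mono_neutral_left) (auto intro!: binomial_eq_0)

lemma rev_dickson2_0 [simp]: "rev_dickson2 0 = 1"
  and rev_dickson2_1 [simp]: "rev_dickson2 (Suc 0) = 1"
  by (simp_all add: rev_dickson2_def)

lemma rev_dickson2_rec: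
  "rev_dickson2 (Suc (Suc n)) = rev_dickson2 (Suc n) - [:0, 1:] * rev_dickson2 n"
proof -
  define y :: "int poly" where "y = - [:0, 1:]"
  have "rev_dickson2 (Suc (Suc n)) =
      1 + (\<Sum>i\<le>n. of_nat (Suc (n - i) choose Suc i) * y ^ Suc i)"
    unfolding rev_dickson2_altdef y_def[symmetric] sum.atMost_Suc_shift[of _ "Suc n"]
    by (simp add: Suc_diff_le)
  also have "\<dots> = 1 + (\<Sum>i\<le>n. of_nat ((n - i) choose Suc i) * y ^ Suc i)
      + y * (\<Sum>i\<le>n. of_nat ((n - i) choose i) * y ^ i)"
    by (simp add: sum_distrib_left flip: sum.distrib) (simp add: algebra_simps)
  also have "1 + (\<Sum>i\<le>n. of_nat ((n - i) choose Suc i) * y ^ Suc i) = rev_dickson2 (Suc n)"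
    unfolding rev_dickson2_altdef y_def[symmetric] sum.atMost_Suc_shift by simp
  also have "(\<Sum>i\<le>n. of_nat ((n - i) choose i) * y ^ i) = rev_dickson2 n"
    unfolding rev_dickson2_altdef y_def ..
  finally show ?thesis by (simp add: y_def)
qed

lemma poly_rev_dickson2_rec [simp]:
  "poly (rev_dickson2 (Suc (Suc n))) x = poly (rev_dickson2 (Suc n)) x - x * poly (rev_dickson2 n) x"
  by (simp add: rev_dickson2_rec)

text \<open>The recurrence is what remains of the one for \<open>E n a - E n b\<close> after division by \<open>a - b\<close>.  As
  a definition it makes sense for \<open>a = b\<close> too, where it gives the derivative.\<close>

fun divided_difference :: "int \<Rightarrow> int \<Rightarrow> nat \<Rightarrow> int" where
  "divided_difference a b 0 = 0"
| "divided_difference a b (Suc 0) = 0"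
| "divided_difference a b (Suc (Suc n)) =
     divided_difference a b (Suc n) - a * divided_difference a b n - poly (rev_dickson2 n) b"

lemma poly_rev_dickson2_diff:
  "poly (rev_dickson2 n) a - poly (rev_dickson2 n) b = (a - b) * divided_difference a b n"
proof (induction n rule: induct_nat_012)
  case (ge2 n)
  let ?E = "\<lambda>n. poly (rev_dickson2 n)"
  have "?E (Suc (Suc n)) a - ?E (Suc (Suc n)) b =
      (?E (Suc n) a - ?E (Suc n) b) - a * (?E n a - ?E n b) - (a - b) * ?E n b"
    by (simp add: algebra_simps)
  then show ?case unfolding ge2 by (simp add: algebra_simps)
qed simp_all

section \<open>Values modulo 2 and modulo 4\<close>

lemma odd_poly_rev_dickson2_at_even:
  "even x \<Longrightarrow> odd (poly (rev_dickson2 n) x)"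
  by (induction n rule: induct_nat_012) auto

text \<open>At an odd argument the recurrence reads \<open>E (n + 2) = E (n + 1) + E n\<close> modulo 2: the parities
  are those of the Fibonacci numbers.\<close>

lemma even_poly_rev_dickson2_at_odd:
  "odd x \<Longrightarrow> even (poly (rev_dickson2 n) x) \<longleftrightarrow> n mod 3 = 2"
proof (induction n rule: induct_nat_012)
  case (ge2 n)
  then have "even (poly (rev_dickson2 (Suc (Suc n))) x) \<longleftrightarrow> (Suc n mod 3 = 2 \<longleftrightarrow> n mod 3 = 2)"
    by auto
  then show ?case by presburger
qed auto

lemma poly_rev_dickson2_0 [simp]: "poly (rev_dickson2 n) 0 = 1"
  by (induction n rule: induct_nat_012) auto

text \<open>Two steps of the recurrence at 2 subtract twice a sum of two odd numbers, hence a multiple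
  of 4.\<close>

lemma poly_rev_dickson2_2_cong_1:
  assumes "odd n"
  shows "[poly (rev_dickson2 n) 2 = 1] (mod 4)"
proof -
  have "[poly (rev_dickson2 (Suc (2 * k))) 2 = 1] (mod 4)" for k
  proof (induction k)
    case (Suc k)
    let ?u = "poly (rev_dickson2 (2 * k)) 2" and ?v = "poly (rev_dickson2 (Suc (2 * k))) 2"
    have "even (?u + ?v)" by (simp add: odd_poly_rev_dickson2_at_even)
    then obtain c where "?u + ?v = 2 * c" by (elim evenE)
    moreover have "poly (rev_dickson2 (Suc (2 * Suc k))) 2 = ?v - 2 * (?u + ?v)" by simp
    ultimately have "poly (rev_dickson2 (Suc (2 * Suc k))) 2 = ?v - 2 * (2 * c)" by (simp only:)
    then have "[poly (rev_dickson2 (Suc (2 * Suc k))) 2 = ?v] (mod 4)"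
      by (simp only: cong_iff_dvd_diff) simp
    then show ?case using Suc.IH cong_trans by blast
  qed simp
  with assms show ?thesis by (auto elim: oddE)
qed

lemma odd_divided_difference_at_even:
  "even a \<Longrightarrow> even b \<Longrightarrow> odd (divided_difference a b n) \<longleftrightarrow> even n \<and> n > 0"
  by (induction n rule: induct_nat_012) (auto simp: odd_poly_rev_dickson2_at_even)

text \<open>Modulo 2 the recurrence is that of the Fibonacci numbers, driven by the values of \<open>E\<close>, which
  have period 3.  The resulting parities \<open>0, 0, 1, 0, 1, 0\<close> have period 6.\<close>

lemma odd_divided_difference_at_odd:
  "odd a \<Longrightarrow> odd b \<Longrightarrow> odd (divided_difference a b n) \<longleftrightarrow> n mod 6 \<in> {2, 4}"
proof (induction n rule: induct_nat_012)
  case (ge2 n)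
  then have "odd (divided_difference a b (Suc (Suc n))) \<longleftrightarrow>
      ((Suc n mod 6 \<in> {2, 4} \<longleftrightarrow> n mod 6 \<in> {2, 4}) \<longleftrightarrow> n mod 3 \<noteq> 2)"
    by (auto simp: even_poly_rev_dickson2_at_odd)
  \<comment> \<open>Every condition depends on \<open>n mod 6\<close> alone, which leaves six cases.\<close>
  moreover define r where "r = n mod 6"
  moreover have "n mod 3 = r mod 3" "Suc n mod 6 = Suc r mod 6"
    "Suc (Suc n) mod 6 = Suc (Suc r) mod 6"
    unfolding r_def by (simp_all add: mod_mod_cancel mod_simps)
  moreover have "r \<in> {0, 1, 2, 3, 4, 5}" unfolding r_def by auto
  ultimately show ?case by (elim insertE emptyE) simp_all
qed auto

section \<open>The criterion\<close>

lemma permutation_poly_mod_2_4_imp: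
  assumes "permutation_poly_mod 2 (rev_dickson2 n)" "permutation_poly_mod 4 (rev_dickson2 n)"
  shows "[n = 2] (mod 6)"
proof -
  have "n mod 3 = 2"
  proof (rule ccontr)
    assume "n mod 3 \<noteq> 2"
    then have "odd (poly (rev_dickson2 n) 1)" by (simp add: even_poly_rev_dickson2_at_odd)
    then have "[poly (rev_dickson2 n) 1 = poly (rev_dickson2 n) 0] (mod 2)"
      by (simp add: cong_def odd_iff_mod_2_eq_one)
    then have "[1 = 0] (mod 2 :: int)"
      using assms(1) permutation_poly_mod_iff_inj[of 2] by simp
    then show False by (simp add: cong_def)
  qed
  moreover have "even n"
  proof (rule ccontr)
    assume "odd n"
    then have "[poly (rev_dickson2 n) 2 = poly (rev_dickson2 n) 0] (mod 4)"
      by (simp add: poly_rev_dickson2_2_cong_1)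
    then have "[2 = 0] (mod 4 :: int)"
      using assms(2) permutation_poly_mod_iff_inj[of 4] by simp
    then show False by (simp add: cong_def)
  qed
  ultimately show ?thesis unfolding cong_def by presburger
qed

text \<open>The divided difference is odd, hence a unit modulo \<open>2 ^ t\<close>, and cancels.\<close>

lemma permutation_poly_mod_power_2:
  assumes n: "[n = 2] (mod 6)"
  shows "permutation_poly_mod (2 ^ t) (rev_dickson2 n)"
proof (cases "t = 0")
  case True
  then show ?thesis by (simp add: permutation_poly_mod_iff_inj)
next
  case False
  have n6: "n mod 6 = 2" using n by (simp add: cong_def)
  then have n3: "n mod 3 = 2" by presburger
  from n6 have n2: "even n" by presburger
  from n6 have n0: "n > 0" by (cases n) simp_all
  have "[a = b] (mod 2 ^ t)"
    if ab: "[poly (rev_dickson2 n) a = poly (rev_dickson2 n) b] (mod 2 ^ t)" for a b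
  proof -
    have sep: "even (poly (rev_dickson2 n) x) \<longleftrightarrow> odd x" for x
      using n3 odd_poly_rev_dickson2_at_even even_poly_rev_dickson2_at_odd by blast
    have "[poly (rev_dickson2 n) a = poly (rev_dickson2 n) b] (mod 2)"
      using ab by (rule cong_dvd_modulus) (use False in auto)
    then have "even a \<longleftrightarrow> even b"
      using sep[of a] sep[of b] by (metis cong_dvd_iff)
    then have "odd (divided_difference a b n)"
      using n0 n2 n6 odd_divided_difference_at_even odd_divided_difference_at_odd
      by (cases "even a") auto
    then have "coprime (2 ^ t) (divided_difference a b n)" by simp
    moreover have "2 ^ t dvd (a - b) * divided_difference a b n"
      using ab by (simp add: cong_iff_dvd_diff poly_rev_dickson2_diff)
    ultimately show ?thesis
      by (simp add: cong_iff_dvd_diff coprime_dvd_mult_left_iff)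
  qed
  then show ?thesis by (simp add: permutation_poly_mod_iff_inj)
qed

theorem theorem4p22:
  fixes t n :: nat
  assumes "t > 1"
  shows "permutation_poly_mod (2 ^ t) (rev_dickson2 n) \<longleftrightarrow> [n = 2] (mod 6)"
proof
  assume perm: "permutation_poly_mod (2 ^ t) (rev_dickson2 n)"
  have "2 ^ 1 dvd (2 ^ t :: int)" "2 ^ 2 dvd (2 ^ t :: int)"
    using assms by (intro le_imp_power_dvd; simp)+
  then show "[n = 2] (mod 6)"
    using permutation_poly_mod_dvd[OF perm] by (intro permutation_poly_mod_2_4_imp) simp_all
qed (rule permutation_poly_mod_power_2)

end
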